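(* Let $\alpha\in(0,1]$ be fixed, let $K\ge 1$ be an integer, and let $\psi>0$ be a constant. Consider a sequence of models indexed by integers $m\ge 1$ such that the data $X_m\in V_m$ ($V_m$ a real vector space of dimension $p_m$) follow the signal-plus-noise model $X_m=s_m+N_m$, where $s_m\in\Theta_m=\{0\}\cup\Theta_{m1}$ is deterministic, $\Theta_{m1}\subset V_m$, and $N_m$ is a random noise vector whose distribution does not depend on $s_m$. Let $\mathcal G_m$ be a compact group acting linearly on $V_m$, with Haar probability measure $Q_m$, and let the test statistic $f_m:V_m\to\mathbb R$ be $\psi$-subadditive. Test the sequence of null hypotheses $H_{m0}:s_m=0$ against the sequence of alternative hypotheses $H_{m1}:s_m\in\Theta_{m1}$ by the randomization test with statistic $f_m$, which rejects on the event $$\mathcal E_m=\{f_m(X_m)>q_{1-\alpha}(f_m(X_m),f_m(G_{m1}X_m),\dots,f_m(G_{mK}X_m))\},$$ with $G_{m1},\dots,G_{mK}$ iid from $Q_m$, independent of $N_m$. Consider the following conditions. 1. (Noise invariance) The distribution of the noise is invariant under $\mathcal G_m$: $N_m=_d g_mN_m$ for all $g_m\in\mathcal G_m$. 2. (Signal strength) There is a sequence $(t_m)_{m\ge1}$, and for any sequence $(s_m)_{m\ge1}$ with $s_m\in\Theta_{m1}$ for all $m\ge 1$ there is another sequence $(\tilde t_m)_{m\ge1}$, $\tilde t_m=\tilde t_m(s_m)$, such that for all large enough integers $m$ $$f_m(s_m)>\psi^{-2}\,\tilde t_m(s_m)+\psi^{-1}(\psi^{-1}+1)\,t_m.$$ Further,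 as $m\to\infty$: (a) (Noise level) $P(f_m(N_m)\le t_m)\to1$ and $P(f_m(-N_m)\le t_m)\to 1$; (b) (Bound on randomized statistic) for any sequence $(s_m)_{m\ge1}$ with $s_m\in\Theta_{m1}$ for all $m\ge1$, $P_{G_m\sim Q_m}(f_m(G_ms_m)\le\tilde t_m(s_m))\to1$. Then: (i) Under condition 1, the randomization test has level at most $\alpha$. (ii) Under conditions 1 and 2, the randomization test is consistent: for any sequence $(s_m)_{m\ge1}$ with $s_m\in\Theta_{m1}$ for all $m\ge 1$, $\lim_{m\to\infty}P_{G_{m1},\dots,G_{mK}\sim Q_m,\,N_m}(\mathcal E_m)=1$.
   Context: Compact group means compact Hausdorff topological group with its Borel sigma-algebra; its Haar probability measure is the unique translation-invariant Borel probability measure. The group $\mathcal G_m$ acts on the real vector space $V_m$ through a linear representation $\rho_m:\mathcal G_m\to GL(V_m)$, and $g x:=\rho_m(g)x$. A function $f:V\to\mathbb R$ on a real vector space is $\psi$-subadditive (for $\psi>0$) if $\psi f(a+b)\le f(a)+f(b)$ for all $a,b\in V$. Quantile in the randomization test: let $G_{m0}$ be the identity on $V_m$, let $f_{(1)}\le\dots\le f_{(K+1)}$ be the ordered values of $f_m(G_{mi}X_m)$, $i=0,1,\dots,K$, and $k=\lceil(1-\alpha)(K+1)\rceil$. Then $q_{1-\alpha}(\cdot)=f_{(k)}$, so the test rejects when $f_m(X_m)>f_{(k)}$ (with $f_{(0)}=-\infty$, relevant only if $\alpha=1$). Level at most $\alpha$ means that $P(\mathcal E_m)\le\alpha$ when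 $s_m=0$. $=_d$ denotes equality in distribution.
   Formalization: Part (ii) is proved under the extra condition α(K+1) ≥ 1; for α < 1/(K+1) the quantile is the maximum of the K+1 values, so the test never rejects and consistency fails. *)

theory Defs
  imports "HOL-Probability.Probability" "HOL-Algebra.Group_Action"
begin

definition compact_group :: "('g, 'b) monoid_scheme \<Rightarrow> 'g topology \<Rightarrow> bool" where
  "compact_group G T \<longleftrightarrow>
     group G \<and> topspace T = carrier G \<and> compact_space T \<and> Hausdorff_space T \<and>
     continuous_map (prod_topology T T) T (\<lambda>(g, h). g \<otimes>\<^bsub>G\<^esub> h) \<and>
     continuous_map T T (\<lambda>g. inv\<^bsub>G\<^esub> g)"

definition borel_of :: "'g topology \<Rightarrow> 'g measure" where
  "borel_of T = sigma (topspace T) {U. openin T U}"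

text \<open>Left invariance, as usual; on a compact group it entails right invariance.
  Regularity is not required.\<close>

definition haar_prob :: "('g, 'b) monoid_scheme \<Rightarrow> 'g topology \<Rightarrow> 'g measure \<Rightarrow> bool" where
  "haar_prob G T Q \<longleftrightarrow>
     prob_space Q \<and> sets Q = sets (borel_of T) \<and>
     (\<forall>h\<in>carrier G. distr Q Q (\<lambda>g. h \<otimes>\<^bsub>G\<^esub> g) = Q)"

text \<open>Vector spaces whose dimension varies with an index are represented as finite-dimensional
  subspaces of one ambient inner product space, into which every sequence of finite-dimensional
  real vector spaces embeds. The ambient inner product serves only to provide the Borel sets:
  the topology it induces on such a subspace is the unique Hausdorff vector space topology.\<close>

definition fin_dim_space :: "'v::real_inner set \<Rightarrow> nat \<Rightarrow> bool" where
  "fin_dim_space V p \<longleftrightarrow> (\<exists>B. finite B \<and> independent B \<and> card B = p \<and> span B = V)"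

abbreviation borel_on :: "'v::real_inner set \<Rightarrow> 'v measure" where
  "borel_on V \<equiv> restrict_space borel V"

text \<open>The predicate \<open>group_action\<close> says that \<open>\<rho>\<close> is a homomorphism from \<open>G\<close> to the group of
  bijections of \<open>V\<close>; with linearity it is a homomorphism to the general linear group of \<open>V\<close>.
  Measurability of the maps \<open>g \<mapsto> \<rho> g x\<close> holds for every continuous representation.\<close>

definition linear_representation ::
  "('g, 'b) monoid_scheme \<Rightarrow> 'g topology \<Rightarrow> 'v::real_inner set \<Rightarrow> ('g \<Rightarrow> 'v \<Rightarrow> 'v) \<Rightarrow> bool" where
  "linear_representation G T V \<rho> \<longleftrightarrow>
     group_action G V \<rho> \<and>
     (\<forall>g\<in>carrier G. \<forall>x\<in>V. \<forall>y\<in>V. \<rho> g (x + y) = \<rho> g x + \<rho> g y) \<and>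
     (\<forall>g\<in>carrier G. \<forall>x\<in>V. \<forall>c. \<rho> g (c *\<^sub>R x) = c *\<^sub>R \<rho> g x) \<and>
     (\<forall>x\<in>V. (\<lambda>g. \<rho> g x) \<in> borel_of T \<rightarrow>\<^sub>M borel_on V)"

definition psi_subadditive :: "real \<Rightarrow> 'v::real_inner set \<Rightarrow> ('v \<Rightarrow> real) \<Rightarrow> bool" where
  "psi_subadditive \<psi> V f \<longleftrightarrow> (\<forall>a\<in>V. \<forall>b\<in>V. \<psi> * f (a + b) \<le> f a + f b)"

text \<open>Order statistics are counted from 1, list positions from 0. The value \<open>-\<infinity>\<close> is
  taken only if \<open>\<alpha> \<ge> 1\<close>.\<close>

definition upper_quantile :: "real \<Rightarrow> real list \<Rightarrow> ereal" where
  "upper_quantile \<alpha> ys =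
     (let k = nat \<lceil>(1 - \<alpha>) * real (length ys)\<rceil>
      in if k = 0 then -\<infinity> else ereal (sort ys ! (k - 1)))"

definition rejects ::
  "real \<Rightarrow> nat \<Rightarrow> ('v \<Rightarrow> real) \<Rightarrow> ('g \<Rightarrow> 'v \<Rightarrow> 'v) \<Rightarrow> (nat \<Rightarrow> 'g) \<Rightarrow> 'v \<Rightarrow> bool" where
  "rejects \<alpha> K f \<rho> g x \<longleftrightarrow>
     ereal (f x) > upper_quantile \<alpha> (f x # map (\<lambda>i. f (\<rho> (g i) x)) [1..<Suc K])"

text \<open>For \<open>\<alpha> < 1 / (K + 1)\<close> the quantile is the maximum of the \<open>K + 1\<close> values,
  one of which is \<open>f x\<close>, so the test never rejects and cannot be consistent.\<close>

lemma not_rejects_small_level: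
  assumes "0 < \<alpha>" "\<alpha> * real (K + 1) < 1"
  shows "\<not> rejects \<alpha> K f \<rho> g x"
proof -
  define ys where "ys = f x # map (\<lambda>i. f (\<rho> (g i) x)) [1..<Suc K]"
  have len: "length ys = Suc K" by (simp add: ys_def)
  have "\<lceil>(1 - \<alpha>) * real (Suc K)\<rceil> = int (Suc K)"
    using assms by (intro ceiling_unique) (auto simp: algebra_simps)
  then have q: "upper_quantile \<alpha> ys = ereal (sort ys ! K)"
    by (simp add: upper_quantile_def len nat_add_distrib Let_def del: of_nat_Suc)
  have "f x \<in> set (sort ys)" unfolding set_sort ys_def by simp
  then obtain i where "i < length ys" "sort ys ! i = f x"
    by (metis in_set_conv_nth length_sort)
  then have "f x \<le> sort ys ! K"
    using sorted_nth_mono[OF sorted_sort, of i K ys] len by simp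
  then show ?thesis
    unfolding rejects_def ys_def[symmetric] q by simp
qed

text \<open>In \<open>prob_space.indep_var\<close> both random variables have values in the same type.\<close>

definition indep_rv ::
  "'w measure \<Rightarrow> 'a measure \<Rightarrow> ('w \<Rightarrow> 'a) \<Rightarrow> 'b measure \<Rightarrow> ('w \<Rightarrow> 'b) \<Rightarrow> bool" where
  "indep_rv M S Y S' Y' \<longleftrightarrow>
     Y \<in> M \<rightarrow>\<^sub>M S \<and> Y' \<in> M \<rightarrow>\<^sub>M S' \<and>
     prob_space.indep_set M
       {Y -` A \<inter> space M | A. A \<in> sets S} {Y' -` A \<inter> space M | A. A \<in> sets S'}"

text \<open>The noise \<open>N m\<close> is one random vector for all signals, so its law does not depend on the
  signal. It lives on the probability space \<open>M m\<close>, together with the random group elements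
  \<open>\<Gamma> m 1, \<dots>, \<Gamma> m K\<close>.\<close>

definition noise_invariance ::
  "(nat \<Rightarrow> ('g, 'b) monoid_scheme) \<Rightarrow> (nat \<Rightarrow> 'v::real_inner set) \<Rightarrow> (nat \<Rightarrow> 'g \<Rightarrow> 'v \<Rightarrow> 'v) \<Rightarrow>
   (nat \<Rightarrow> 'w measure) \<Rightarrow> (nat \<Rightarrow> 'w \<Rightarrow> 'v) \<Rightarrow> bool" where
  "noise_invariance G V \<rho> M N \<longleftrightarrow>
     (\<forall>m\<ge>1. \<forall>g\<in>carrier (G m).
        distr (M m) (borel_on (V m)) (N m) =
        distr (M m) (borel_on (V m)) (\<lambda>\<omega>. \<rho> m g (N m \<omega>)))"

definition signal_strength ::
  "real \<Rightarrow> (nat \<Rightarrow> 'g measure) \<Rightarrow> (nat \<Rightarrow> 'g \<Rightarrow> 'v \<Rightarrow> 'v) \<Rightarrow> (nat \<Rightarrow> 'v \<Rightarrow> real) \<Rightarrow>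
   (nat \<Rightarrow> 'v::real_inner set) \<Rightarrow> (nat \<Rightarrow> 'w measure) \<Rightarrow> (nat \<Rightarrow> 'w \<Rightarrow> 'v) \<Rightarrow> bool" where
  "signal_strength \<psi> Q \<rho> f \<Theta>1 M N \<longleftrightarrow>
     (\<exists>t :: nat \<Rightarrow> real.
        (\<lambda>m. \<P>(\<omega> in M m. f m (N m \<omega>) \<le> t m)) \<longlonglongrightarrow> 1 \<and>
        (\<lambda>m. \<P>(\<omega> in M m. f m (- N m \<omega>) \<le> t m)) \<longlonglongrightarrow> 1 \<and>
        (\<forall>s. (\<forall>m\<ge>1. s m \<in> \<Theta>1 m) \<longrightarrow>
           (\<exists>t' :: nat \<Rightarrow> real.
              (\<forall>\<^sub>F m in sequentially.
                 f m (s m) > t' m / \<psi>\<^sup>2 + (1 / \<psi>) * (1 / \<psi> + 1) * t m) \<and>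
              (\<lambda>m. \<P>(g in Q m. f m (\<rho> m g (s m)) \<le> t' m)) \<longlonglongrightarrow> 1)))"

end

theory Submission
  imports Defs
begin

text \<open>The test rejects iff sufficiently many of the randomized statistics lie strictly below the
  observed one. For the level, replace the noise \<open>N\<close> by \<open>h N\<close> with \<open>h\<close> uniform: by right invariance
  of the law of the orbit maps, the observed and the randomized statistics are iid given \<open>N\<close>, so
  all ranks of the observed one are equally likely up to ties. For consistency, subadditivity
  gives \<open>f (s + N) \<ge> \<psi> f s - f (- N)\<close> and \<open>f (g (s + N)) \<le> (f (g s) + f (g N)) / \<psi>\<close>; the signal
  condition separates the two bounds off events of vanishing probability, and a union bound over
  the \<open>K\<close> group elements finishes the proof.\<close>

section \<open>Ranks\<close>

text \<open>In the sorted list the entries below \<open>y\<close> form an initial segment, and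
  position \<open>k - 1\<close> belongs to that segment exactly when its length is at least
  \<open>k\<close>.\<close>

lemma less_nth_sort_iff:
  fixes ys :: "'a::linorder list"
  assumes "0 < k" "k \<le> length ys"
  shows "sort ys ! (k - 1) < y \<longleftrightarrow> k \<le> length (filter (\<lambda>z. z < y) ys)"
proof -
  define zs where "zs = sort ys"
  have sorted: "sorted zs" and len: "length zs = length ys"
    by (simp_all add: zs_def)
  have "length (filter (\<lambda>z. z < y) ys) = length (filter (\<lambda>z. z < y) zs)"
    by (metis mset_filter mset_sort size_mset zs_def)
  also have "\<dots> = card {i. i < length zs \<and> zs ! i < y}" (is "_ = card ?I")
    by (rule length_filter_conv_card)
  finally have card: "length (filter (\<lambda>z. z < y) ys) = card ?I" .
  show ?thesis
  proof
    assume less: "sort ys ! (k - 1) < y"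
    have "{..<k} \<subseteq> ?I"
    proof
      fix i assume "i \<in> {..<k}"
      then have "zs ! i \<le> zs ! (k - 1)" "i < length zs"
        using assms len by (auto intro!: sorted_nth_mono[OF sorted])
      then show "i \<in> ?I" using less by (simp add: zs_def)
    qed
    from card_mono[OF _ this] show "k \<le> length (filter (\<lambda>z. z < y) ys)"
      by (simp add: card)
  next
    assume "k \<le> length (filter (\<lambda>z. z < y) ys)"
    moreover have "card ?I < k" if ge: "y \<le> zs ! (k - 1)"
    proof -
      have "?I \<subseteq> {..<k - 1}"
      proof
        fix i assume i: "i \<in> ?I"
        have False if "k - 1 \<le> i"
        proof -
          have "zs ! (k - 1) \<le> zs ! i"
            using that i by (intro sorted_nth_mono[OF sorted]) auto
          then show False using ge i by auto
        qed
        then show "i \<in> {..<k - 1}" by force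
      qed
      from card_mono[OF _ this] show ?thesis using assms by simp
    qed
    ultimately show "sort ys ! (k - 1) < y"
      by (fastforce simp: card zs_def not_le)
  qed
qed

text \<open>The observed value is never strictly below itself, so only the \<open>K\<close>
  randomized values are counted, although the quantile is taken over \<open>K + 1\<close> values.
  From here on the test is a condition on a rank.\<close>

lemma rejects_iff:
  assumes "0 \<le> \<alpha>" "\<alpha> \<le> 1"
  shows "rejects \<alpha> K f \<rho> g x \<longleftrightarrow>
    nat \<lceil>(1 - \<alpha>) * real (K + 1)\<rceil> \<le> card {i\<in>{1..K}. f (\<rho> (g i) x) < f x}"
proof -
  define k where "k = nat \<lceil>(1 - \<alpha>) * real (K + 1)\<rceil>"
  define ys where "ys = f x # map (\<lambda>i. f (\<rho> (g i) x)) [1..<Suc K]"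
  have len: "length ys = Suc K" by (simp add: ys_def)
  have "(1 - \<alpha>) * real (K + 1) \<le> 1 * real (K + 1)"
    using assms by (intro mult_right_mono) auto
  then have kle: "k \<le> length ys"
    unfolding k_def len by (simp add: ceiling_le_iff nat_le_iff)
  have "length (filter (\<lambda>z. z < f x) ys) = length (filter (\<lambda>i. f (\<rho> (g i) x) < f x) [1..<Suc K])"
    by (simp add: ys_def filter_map o_def del: upt_Suc)
  also have "\<dots> = card (set (filter (\<lambda>i. f (\<rho> (g i) x) < f x) [1..<Suc K]))"
    by (rule distinct_card[symmetric]) simp
  also have "set (filter (\<lambda>i. f (\<rho> (g i) x) < f x) [1..<Suc K]) = {i\<in>{1..K}. f (\<rho> (g i) x) < f x}"
    by auto
  finally have card: "length (filter (\<lambda>z. z < f x) ys) = card {i\<in>{1..K}. f (\<rho> (g i) x) < f x}" .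
  show ?thesis
  proof (cases "k = 0")
    \<comment> \<open>This happens only for \<open>\<alpha> = 1\<close>; the quantile is minus
      infinity and both sides hold.\<close>
    case True
    then show ?thesis
      using len unfolding rejects_def ys_def[symmetric] upper_quantile_def
      by (simp add: k_def)
  next
    case False
    then have "upper_quantile \<alpha> ys = ereal (sort ys ! (k - 1))"
      using len by (simp add: upper_quantile_def k_def Let_def)
    then have "rejects \<alpha> K f \<rho> g x \<longleftrightarrow> sort ys ! (k - 1) < f x"
      unfolding rejects_def ys_def[symmetric] by simp
    also have "\<dots> \<longleftrightarrow> k \<le> card {i\<in>{1..K}. f (\<rho> (g i) x) < f x}"
      using less_nth_sort_iff[OF _ kle, of "f x"] False card by simp
    finally show ?thesis by (simp add: k_def)
  qed
qed

text \<open>Take \<open>j\<close> with the smallest value among the counted indices. At least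
  \<open>k\<close> indices lie strictly below it, and minimality keeps all of them out of the
  counted set. Ties do no harm, because only strict inequalities are counted.\<close>

lemma card_ranked_le:
  fixes y :: "'i \<Rightarrow> 'a::linorder"
  assumes "finite I" "k \<le> card I"
  shows "card {j\<in>I. k \<le> card {i\<in>I. y i < y j}} \<le> card I - k"
proof -
  define J where "J = {j\<in>I. k \<le> card {i\<in>I. y i < y j}}"
  have J: "J \<subseteq> I" and fin: "finite J" using assms by (auto simp: J_def)
  show ?thesis
  proof (cases "J = {}")
    case False
    then obtain j where j: "j \<in> J" "\<And>i. i \<in> J \<Longrightarrow> y j \<le> y i"
      using fin by (metis arg_min_if_finite(1) arg_min_least)
    let ?B = "{i\<in>I. y i < y j}"
    have "J \<inter> ?B = {}" using j(2) by (auto simp: not_less[symmetric])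
    then have "card J + card ?B = card (J \<union> ?B)"
      using assms fin by (intro card_Un_disjoint[symmetric]) auto
    also have "\<dots> \<le> card I" using assms J by (intro card_mono) auto
    finally have "card J + card ?B \<le> card I" .
    moreover have "k \<le> card ?B" using j(1) by (simp add: J_def)
    ultimately show ?thesis by (simp add: J_def)
  qed (simp flip: J_def)
qed

lemma pred_rank:
  fixes Y :: "nat \<Rightarrow> 'a \<Rightarrow> real"
  assumes "Z \<in> borel_measurable M" "\<And>i. i \<in> I \<Longrightarrow> Y i \<in> borel_measurable M"
  shows "Measurable.pred M (\<lambda>x. k \<le> card {i\<in>I. Y i x < Z x})"
proof -
  have [measurable]: "{x\<in>space M. i \<in> {i\<in>I. Y i x < Z x}} \<in> sets M" for i
    using assms by (cases "i \<in> I") auto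
  show ?thesis by measurable
qed

text \<open>The coordinates are iid, so each of them is equally likely to have at least \<open>k\<close>
  coordinates below it, and at most \<open>n + 1 - k\<close> coordinates do.\<close>

lemma prob_ranked_le:
  fixes D :: "real measure"
  assumes "prob_space D" and sets: "sets D = sets borel" and k: "k \<le> Suc n"
  defines "P \<equiv> PiM {0..n} (\<lambda>_. D)"
  shows "measure P {y\<in>space P. k \<le> card {i\<in>{0..n}. y i < y 0}} \<le> real (Suc n - k) / real (Suc n)"
proof -
  interpret D: prob_space D by fact
  have P: "prob_space P" unfolding P_def by (intro prob_space_PiM D.prob_space_axioms)
  interpret P: prob_space P by fact
  have coord [measurable]: "(\<lambda>y. y i) \<in> borel_measurable P" if "i \<in> {0..n}" for i
    unfolding P_def using that sets by (metis measurable_component_singleton measurable_cong_sets)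
  define A where "A j = {y\<in>space P. k \<le> card {i\<in>{0..n}. y i < y j}}" for j
  have Am [measurable]: "A j \<in> sets P" if j: "j \<in> {0..n}" for j
  proof -
    have "Measurable.pred P (\<lambda>y. k \<le> card {i\<in>{0..n}. y i < y j})"
      by (intro pred_rank coord j)
    then show ?thesis unfolding A_def by (rule predE)
  qed
  have same: "measure P (A j) = measure P (A 0)" if j: "j \<in> {0..n}" for j
  proof -
    \<comment> \<open>Swapping the coordinates \<open>0\<close> and \<open>j\<close> preserves the
      power of \<open>D\<close> and pulls the event for coordinate \<open>0\<close> back to the
      event for \<open>j\<close>.\<close>
    define \<sigma> where "\<sigma> = Transposition.transpose 0 j"
    have perm: "\<sigma> permutes {0..n}" unfolding \<sigma>_def using j by (intro permutes_swap_id) auto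
    have dist: "distr P P (\<lambda>\<omega>. \<lambda>i\<in>{0..n}. \<omega> (\<sigma> i)) = P"
      unfolding P_def
      using permutes_inj_on[OF perm, of "{0..n}"] permutes_in_image[OF perm] D.prob_space_axioms
      by (intro distr_PiM_reindex) auto
    have meas: "(\<lambda>\<omega>. \<lambda>i\<in>{0..n}. \<omega> (\<sigma> i)) \<in> P \<rightarrow>\<^sub>M P"
      unfolding P_def using permutes_in_image[OF perm]
      by (intro measurable_restrict measurable_component_singleton) auto
    have card: "card {i\<in>{0..n}. \<omega> (\<sigma> i) < \<omega> (\<sigma> 0)} = card {i\<in>{0..n}. \<omega> i < \<omega> j}" for \<omega> :: "nat \<Rightarrow> real"
    proof -
      have mem: "\<sigma> i \<in> {0..n} \<longleftrightarrow> i \<in> {0..n}" for i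
        using permutes_in_image[OF perm] .
      have inv: "\<sigma> (\<sigma> i) = i" and zero: "\<sigma> 0 = j" for i
        by (simp_all add: \<sigma>_def)
      \<comment> \<open>The swap is an involution of the index range, so it matches the indices
        counted before it with those counted after it.\<close>
      have "{i\<in>{0..n}. \<omega> i < \<omega> j} = \<sigma> ` {i\<in>{0..n}. \<omega> (\<sigma> i) < \<omega> (\<sigma> 0)}"
      proof (rule Set.set_eqI)
        fix i
        show "i \<in> {i\<in>{0..n}. \<omega> i < \<omega> j} \<longleftrightarrow> i \<in> \<sigma> ` {i\<in>{0..n}. \<omega> (\<sigma> i) < \<omega> (\<sigma> 0)}"
          using mem[of i] inv[of i] mem inv zero by (force intro: image_eqI[of _ _ "\<sigma> i"])
      qed
      then show ?thesis by (simp add: card_image permutes_inj_on[OF perm])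
    qed
    have "measure P (A 0) = measure (distr P P (\<lambda>\<omega>. \<lambda>i\<in>{0..n}. \<omega> (\<sigma> i))) (A 0)"
      by (simp add: dist)
    also have "\<dots> = measure P ((\<lambda>\<omega>. \<lambda>i\<in>{0..n}. \<omega> (\<sigma> i)) -` A 0 \<inter> space P)"
      by (intro measure_distr meas Am) auto
    also have "(\<lambda>\<omega>. \<lambda>i\<in>{0..n}. \<omega> (\<sigma> i)) -` A 0 \<inter> space P = A j"
      using measurable_space[OF meas] by (auto simp: A_def card[simplified] cong: conj_cong)
    finally show ?thesis ..
  qed
  \<comment> \<open>The sum of the equal probabilities is the expected number of coordinates that
    have at least \<open>k\<close> others below them. This number is bounded pointwise by
    \<open>card_ranked_le\<close>.\<close>
  have "real (Suc n) * measure P (A 0) = (\<Sum>j\<in>{0..n}. measure P (A 0))"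
    by simp
  also have "\<dots> = (\<Sum>j\<in>{0..n}. measure P (A j))"
    by (intro sum.cong same[symmetric]) auto
  also have "\<dots> = (\<Sum>j\<in>{0..n}. P.expectation (indicator (A j)))"
    using Am by simp
  also have "\<dots> = P.expectation (\<lambda>y. \<Sum>j\<in>{0..n}. indicator (A j) y)"
    using Am by (subst Bochner_Integration.integral_sum) (auto simp: P.emeasure_eq_measure)
  also have "\<dots> \<le> P.expectation (\<lambda>y. real (Suc n - k))"
  proof (rule integral_mono)
    show "integrable P (\<lambda>y. \<Sum>j\<in>{0..n}. indicator (A j) y :: real)"
      using Am by (intro Bochner_Integration.integrable_sum) (auto simp: P.emeasure_eq_measure)
    fix y assume "y \<in> space P"
    then have "(\<Sum>j\<in>{0..n}. indicator (A j) y :: real) = real (card {j\<in>{0..n}. k \<le> card {i\<in>{0..n}. y i < y j}})"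
      by (simp add: A_def indicator_def sum.If_cases Int_def)
    also have "\<dots> \<le> real (card {0..n} - k)"
      using k by (intro of_nat_mono card_ranked_le) auto
    finally show "(\<Sum>j\<in>{0..n}. indicator (A j) y :: real) \<le> real (Suc n - k)" by simp
  qed simp
  also have "\<dots> = real (Suc n - k)" by (simp add: P.prob_space)
  finally show ?thesis by (simp add: A_def field_simps del: of_nat_Suc)
qed

section \<open>Linear representations of compact groups\<close>

lemma space_borel_of: "space (borel_of T) = topspace T"
  unfolding borel_of_def by (auto intro!: space_measure_of dest: openin_subset)

lemma borel_of_measurable_continuous_map:
  assumes "continuous_map S T F"
  shows "F \<in> borel_of S \<rightarrow>\<^sub>M borel_of T"
  unfolding borel_of_def[of T]
proof (rule measurable_measure_of)
  show "{U. openin T U} \<subseteq> Pow (topspace T)" by (auto dest: openin_subset)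
  show "F \<in> space (borel_of S) \<rightarrow> topspace T"
    using continuous_map_funspace[OF assms] by (simp add: space_borel_of)
  fix U assume "U \<in> {U. openin T U}"
  then have "openin S {x \<in> topspace S. F x \<in> U}"
    using openin_continuous_map_preimage[OF assms] by simp
  moreover have "F -` U \<inter> space (borel_of S) = {x \<in> topspace S. F x \<in> U}"
    by (auto simp: space_borel_of)
  ultimately show "F -` U \<inter> space (borel_of S) \<in> sets (borel_of S)"
    by (auto simp: borel_of_def intro!: in_measure_of dest: openin_subset)
qed

text \<open>The ambient space need not be separable, so a sum of Borel functions cannot simply be
  taken to be Borel. With simple functions as coefficients the sum is itself simple, and pointwise
  limits of Borel functions into a metric space are Borel.\<close>

lemma borel_measurable_sum_scaleR:
  fixes c :: "'i \<Rightarrow> 'a \<Rightarrow> real" and v :: "'i \<Rightarrow> 'v::real_inner"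
  assumes "\<And>i. i \<in> I \<Longrightarrow> c i \<in> borel_measurable M"
  shows "(\<lambda>x. \<Sum>i\<in>I. c i x *\<^sub>R v i) \<in> borel_measurable M"
proof -
  have "\<exists>u. (\<forall>n. simple_function M (u n)) \<and> (\<forall>x\<in>space M. (\<lambda>n. u n x) \<longlonglongrightarrow> c i x)"
    if "i \<in> I" for i
    using borel_measurable_implies_sequence_metric[OF assms[OF that], of 0] by metis
  then obtain u where u: "\<And>i n. i \<in> I \<Longrightarrow> simple_function M (u i n)"
    "\<And>i x. i \<in> I \<Longrightarrow> x \<in> space M \<Longrightarrow> (\<lambda>n. u i n x) \<longlonglongrightarrow> c i x"
    by metis
  show ?thesis
  proof (rule borel_measurable_LIMSEQ_metric)
    show "(\<lambda>x. \<Sum>i\<in>I. u i n x *\<^sub>R v i) \<in> borel_measurable M" for n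
      by (intro borel_measurable_simple_function simple_function_sum
          simple_function_compose1[of _ _ "\<lambda>r. r *\<^sub>R _"] u)
    show "(\<lambda>n. \<Sum>i\<in>I. u i n x *\<^sub>R v i) \<longlonglongrightarrow> (\<Sum>i\<in>I. c i x *\<^sub>R v i)" if "x \<in> space M" for x
      using that by (intro tendsto_intros u)
  qed
qed

text \<open>Gram-Schmidt makes the coefficients explicit continuous functions of \<open>x\<close>;
  this is what yields measurable coordinates on \<open>V\<close>.\<close>

lemma fin_dim_space_orthogonal_expansion:
  assumes "fin_dim_space V p"
  obtains C where "finite C" "C \<subseteq> V"
    "\<And>x. x \<in> V \<Longrightarrow> x = (\<Sum>b\<in>C. (x \<bullet> b / (b \<bullet> b)) *\<^sub>R b)"
proof -
  obtain B where "finite B" and V: "V = span B"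
    using assms by (auto simp: fin_dim_space_def)
  then obtain C where C: "finite C" "span C = V" "pairwise orthogonal C"
    using basis_orthogonal[of B] by metis
  have "x = (\<Sum>b\<in>C. (x \<bullet> b / (b \<bullet> b)) *\<^sub>R b)" if x: "x \<in> V" for x
  proof -
    obtain u where u: "x = (\<Sum>b\<in>C. u b *\<^sub>R b)"
      using x C span_finite[OF C(1)] by auto
    have "x \<bullet> b = u b * (b \<bullet> b)" if b: "b \<in> C" for b
    proof -
      have "x \<bullet> b = (\<Sum>a\<in>C. u a * (a \<bullet> b))" by (simp add: u inner_sum_left)
      also have "\<dots> = (\<Sum>a\<in>C. if a = b then u b * (b \<bullet> b) else 0)"
        using C(3) b by (intro sum.cong) (auto simp: pairwise_def orthogonal_def)
      finally show ?thesis using C(1) b by simp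
    qed
    \<comment> \<open>The orthogonal family may contain \<open>0\<close>. Division by zero then
      gives the coefficient \<open>0\<close>, and both sides vanish.\<close>
    then have "u b *\<^sub>R b = (x \<bullet> b / (b \<bullet> b)) *\<^sub>R b" if "b \<in> C" for b
      using that by (cases "b = 0") auto
    then show ?thesis using u by (metis (no_types, lifting) sum.cong)
  qed
  then show ?thesis using that C span_superset by metis
qed

text \<open>Independence is the product formula on measurable rectangles, and these determine a
  product of probability measures.\<close>

lemma (in prob_space) indep_rv_distr:
  assumes "indep_rv M S Y S' Y'"
  shows "distr M (S \<Otimes>\<^sub>M S') (\<lambda>\<omega>. (Y \<omega>, Y' \<omega>)) = distr M S Y \<Otimes>\<^sub>M distr M S' Y'"
proof -
  have [measurable]: "Y \<in> M \<rightarrow>\<^sub>M S" "Y' \<in> M \<rightarrow>\<^sub>M S'"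
    and indep: "indep_set {Y -` A \<inter> space M | A. A \<in> sets S} {Y' -` A \<inter> space M | A. A \<in> sets S'}"
    using assms by (auto simp: indep_rv_def)
  interpret Y: prob_space "distr M S Y" by (rule prob_space_distr) measurable
  interpret Y': prob_space "distr M S' Y'" by (rule prob_space_distr) measurable
  show ?thesis
  proof (rule pair_measure_eqI[symmetric])
    fix A B assume "A \<in> sets (distr M S Y)" "B \<in> sets (distr M S' Y')"
    then have AB [measurable]: "A \<in> sets S" "B \<in> sets S'" by auto
    have "(\<lambda>\<omega>. (Y \<omega>, Y' \<omega>)) -` (A \<times> B) \<inter> space M = (Y -` A \<inter> space M) \<inter> (Y' -` B \<inter> space M)"
      by auto
    moreover have "prob ((Y -` A \<inter> space M) \<inter> (Y' -` B \<inter> space M)) =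
        prob (Y -` A \<inter> space M) * prob (Y' -` B \<inter> space M)"
      using AB by (intro indep_setD[OF indep]) auto
    ultimately show "emeasure (distr M S Y) A * emeasure (distr M S' Y') B =
        emeasure (distr M (S \<Otimes>\<^sub>M S') (\<lambda>\<omega>. (Y \<omega>, Y' \<omega>))) (A \<times> B)"
      by (simp add: emeasure_distr emeasure_eq_measure ennreal_mult)
  qed (auto intro: Y.sigma_finite_measure Y'.sigma_finite_measure cong: sets_pair_measure_cong)
qed

text \<open>One member of the sequence of models, without its noise: a fixed group with its action
  and its Haar measure.\<close>

locale haar_representation =
  fixes G :: "('g, 'b) monoid_scheme" (structure)
    and T :: "'g topology" and V :: "'v::real_inner set" and p :: nat
    and \<rho> :: "'g \<Rightarrow> 'v \<Rightarrow> 'v" and Q :: "'g measure"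
  assumes fin_dim: "fin_dim_space V p"
    and compact_group: "compact_group G T"
    and haar: "haar_prob G T Q"
    and rep: "linear_representation G T V \<rho>"
begin

sublocale group_action G V \<rho>
  using rep by (simp add: linear_representation_def)

sublocale group G
  using compact_group by (simp add: compact_group_def)

sublocale Q: prob_space Q
  using haar by (simp add: haar_prob_def)

lemma sets_Q: "sets Q = sets (borel_of T)"
  using haar by (simp add: haar_prob_def)

lemma space_Q: "space Q = carrier G"
  using sets_eq_imp_space_eq[OF sets_Q] compact_group
  by (simp add: space_borel_of compact_group_def)

lemma space_V: "space (borel_on V) = V"
  by (simp add: space_restrict_space)

lemma subspace_V: "subspace V"
  using fin_dim by (auto simp: fin_dim_space_def)

lemma act_closed: "g \<in> carrier G \<Longrightarrow> x \<in> V \<Longrightarrow> \<rho> g x \<in> V"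
  using element_image by blast

lemma act_add: "g \<in> carrier G \<Longrightarrow> x \<in> V \<Longrightarrow> y \<in> V \<Longrightarrow> \<rho> g (x + y) = \<rho> g x + \<rho> g y"
  using rep by (auto simp: linear_representation_def)

lemma act_scaleR: "g \<in> carrier G \<Longrightarrow> x \<in> V \<Longrightarrow> \<rho> g (c *\<^sub>R x) = c *\<^sub>R \<rho> g x"
  using rep by (auto simp: linear_representation_def)

lemma act_sum:
  assumes g: "g \<in> carrier G" and "finite C" "C \<subseteq> V"
  shows "\<rho> g (\<Sum>b\<in>C. c b *\<^sub>R b) = (\<Sum>b\<in>C. c b *\<^sub>R \<rho> g b)"
  using assms(2,3)
proof (induction C rule: finite_induct)
  case empty
  show ?case using act_scaleR[OF g, of 0 0] subspace_0[OF subspace_V] by simp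
next
  case (insert b C)
  then show ?case
    using subspace_sum[OF subspace_V, of C] subspace_scale[OF subspace_V]
    by (simp add: act_add[OF g] act_scaleR[OF g] subset_eq)
qed

lemma measurable_inner_left: "(\<lambda>x. x \<bullet> b) \<in> borel_measurable (borel_on V)"
  by (intro borel_measurable_continuous_on_restrict continuous_intros)

text \<open>The product \<open>\<sigma>\<close>-algebra on the group need not make the multiplication measurable, but
  the action is jointly measurable: by linearity it is a finite sum of products of coordinates.\<close>

lemma measurable_act: "(\<lambda>(g, x). \<rho> g x) \<in> Q \<Otimes>\<^sub>M borel_on V \<rightarrow>\<^sub>M borel_on V"
proof -
  obtain C where C: "finite C" "C \<subseteq> V"
    and expand: "\<And>x. x \<in> V \<Longrightarrow> x = (\<Sum>b\<in>C. (x \<bullet> b / (b \<bullet> b)) *\<^sub>R b)"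
    using fin_dim_space_orthogonal_expansion[OF fin_dim] by metis
  let ?M = "Q \<Otimes>\<^sub>M borel_on V"
  have orbit: "(\<lambda>g. \<rho> g b) \<in> Q \<rightarrow>\<^sub>M borel_on V" if "b \<in> C" for b
    using rep that C(2)
    by (auto simp: linear_representation_def measurable_cong_sets[OF sets_Q refl])
  have entry: "(\<lambda>g. \<rho> g b \<bullet> b') \<in> borel_measurable Q" if "b \<in> C" for b b'
    using measurable_compose[OF orbit[OF that] measurable_inner_left] .
  \<comment> \<open>With \<open>z = (g, x)\<close>, this is the coefficient of \<open>b'\<close> in
    the orthogonal expansion of \<open>\<rho> g x\<close>: a sum over \<open>b\<close> of a
    coordinate of \<open>x\<close> times a matrix entry of \<open>g\<close>.\<close>
  define c where "c b' z = (\<Sum>b\<in>C. (snd z \<bullet> b / (b \<bullet> b)) * (\<rho> (fst z) b \<bullet> b')) / (b' \<bullet> b')"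
    for b' z
  have [measurable]: "c b' \<in> borel_measurable ?M" for b'
    unfolding c_def
    using measurable_compose[OF measurable_snd measurable_inner_left]
      measurable_compose[OF measurable_fst entry]
    by (intro borel_measurable_divide borel_measurable_sum borel_measurable_times) auto
  have eq: "\<rho> g x = (\<Sum>b'\<in>C. c b' (g, x) *\<^sub>R b')" if "g \<in> carrier G" "x \<in> V" for g x
  proof -
    have "\<rho> g x = (\<Sum>b\<in>C. (x \<bullet> b / (b \<bullet> b)) *\<^sub>R \<rho> g b)"
      using act_sum[OF that(1) C, of "\<lambda>b. x \<bullet> b / (b \<bullet> b)"] expand[OF that(2)] by simp
    then have "\<rho> g x \<bullet> b' / (b' \<bullet> b') = c b' (g, x)" for b'
      by (simp add: c_def inner_sum_left)
    then show ?thesis using expand[OF act_closed[OF that]] by simp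
  qed
  have "(\<lambda>z. \<Sum>b'\<in>C. c b' z *\<^sub>R b') \<in> borel_measurable ?M"
    by (rule borel_measurable_sum_scaleR) measurable
  also have "?this \<longleftrightarrow> (\<lambda>(g, x). \<rho> g x) \<in> borel_measurable ?M"
    by (intro measurable_cong) (auto simp: space_pair_measure space_Q space_V eq)
  finally show ?thesis
    by (intro measurable_restrict_space2)
      (auto simp: space_pair_measure space_Q space_V act_closed)
qed

lemma measurable_act_compose [measurable (raw)]:
  assumes "F \<in> M \<rightarrow>\<^sub>M Q" "Y \<in> M \<rightarrow>\<^sub>M borel_on V"
  shows "(\<lambda>x. \<rho> (F x) (Y x)) \<in> M \<rightarrow>\<^sub>M borel_on V"
  using measurable_compose[OF measurable_Pair[OF assms] measurable_act] by simp

lemma measurable_Q_continuous: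
  assumes "continuous_map T T F" shows "F \<in> Q \<rightarrow>\<^sub>M Q"
  using borel_of_measurable_continuous_map[OF assms] measurable_cong_sets[OF sets_Q sets_Q] by simp

lemma measurable_inv: "(\<lambda>g. inv g) \<in> Q \<rightarrow>\<^sub>M Q"
  using compact_group by (intro measurable_Q_continuous) (simp add: compact_group_def)

text \<open>For a fixed left factor, multiplication is a section of a jointly continuous map, hence
  continuous, and this suffices for Borel measurability.\<close>

lemma measurable_left_mult:
  assumes "h \<in> carrier G" shows "(\<lambda>g. h \<otimes> g) \<in> Q \<rightarrow>\<^sub>M Q"
proof (rule measurable_Q_continuous)
  have "continuous_map T (prod_topology T T) (\<lambda>g. (h, g))"
    using assms compact_group by (intro continuous_map_pairedI) (auto simp: compact_group_def)
  moreover have "continuous_map (prod_topology T T) T (\<lambda>(g, h). g \<otimes> h)"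
    using compact_group by (simp add: compact_group_def)
  ultimately show "continuous_map T T (\<lambda>g. h \<otimes> g)"
    using continuous_map_compose[of T "prod_topology T T" "\<lambda>g. (h, g)" T "\<lambda>(g, h). g \<otimes> h"]
    by (simp add: o_def)
qed

section \<open>Invariance of the laws of orbit maps\<close>

lemma nn_integral_left_mult:
  assumes "h \<in> carrier G" and [measurable]: "F \<in> borel_measurable Q"
  shows "(\<integral>\<^sup>+g. F (h \<otimes> g) \<partial>Q) = (\<integral>\<^sup>+g. F g \<partial>Q)"
proof -
  have "(\<integral>\<^sup>+g. F g \<partial>Q) = (\<integral>\<^sup>+g. F g \<partial>distr Q Q (\<lambda>g. h \<otimes> g))"
    using haar assms(1) by (simp add: haar_prob_def)
  also have "\<dots> = (\<integral>\<^sup>+g. F (h \<otimes> g) \<partial>Q)"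
    using measurable_left_mult[OF assms(1)] by (intro nn_integral_distr) auto
  finally show ?thesis ..
qed

text \<open>Averaging \<open>F (g\<inverse> h x)\<close> over \<open>g\<close> and \<open>h\<close> in either order compares the law of the orbit
  map with the law of its inverse; the joint measurability of the action permits the exchange.\<close>

lemma nn_integral_act_inv:
  assumes x: "x \<in> V" and [measurable]: "F \<in> borel_measurable (borel_on V)"
  shows "(\<integral>\<^sup>+g. F (\<rho> (inv g) x) \<partial>Q) = (\<integral>\<^sup>+g. F (\<rho> g x) \<partial>Q)"
proof -
  note [measurable] = measurable_inv
  have [measurable]: "(\<lambda>_. x) \<in> N \<rightarrow>\<^sub>M borel_on V" for N :: "'c measure"
    using x by (intro measurable_const) (simp add: space_V)
  interpret QQ: pair_sigma_finite Q Q ..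
  have "(\<integral>\<^sup>+g. F (\<rho> g x) \<partial>Q) = (\<integral>\<^sup>+g. (\<integral>\<^sup>+h. F (\<rho> h x) \<partial>Q) \<partial>Q)"
    by (simp add: Q.emeasure_space_1)
  also have "\<dots> = (\<integral>\<^sup>+g. (\<integral>\<^sup>+h. F (\<rho> (inv g) (\<rho> h x)) \<partial>Q) \<partial>Q)"
  proof (rule nn_integral_cong)
    fix g assume "g \<in> space Q"
    then have g: "inv g \<in> carrier G" by (simp add: space_Q)
    \<comment> \<open>For fixed \<open>g\<close>, the inner variable \<open>h\<close> is translated
      from the left by the inverse of \<open>g\<close>.\<close>
    have "(\<integral>\<^sup>+h. F (\<rho> h x) \<partial>Q) = (\<integral>\<^sup>+h. F (\<rho> (inv g \<otimes> h) x) \<partial>Q)"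
      by (intro nn_integral_left_mult[OF g, symmetric]) measurable
    also have "\<dots> = (\<integral>\<^sup>+h. F (\<rho> (inv g) (\<rho> h x)) \<partial>Q)"
      using g by (intro nn_integral_cong) (simp add: space_Q composition_rule[OF x])
    finally show "(\<integral>\<^sup>+h. F (\<rho> h x) \<partial>Q) = (\<integral>\<^sup>+h. F (\<rho> (inv g) (\<rho> h x)) \<partial>Q)" .
  qed
  also have "\<dots> = (\<integral>\<^sup>+h. (\<integral>\<^sup>+g. F (\<rho> (inv g) (\<rho> h x)) \<partial>Q) \<partial>Q)"
    by (rule QQ.Fubini') measurable
  also have "\<dots> = (\<integral>\<^sup>+h. (\<integral>\<^sup>+g. F (\<rho> (inv g) x) \<partial>Q) \<partial>Q)"
  proof (rule nn_integral_cong)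
    fix h assume "h \<in> space Q"
    then have h: "h \<in> carrier G" "inv h \<in> carrier G" by (simp_all add: space_Q)
    \<comment> \<open>After the exchange \<open>h\<close> is fixed, and
      \<open>inv g \<otimes> h\<close> is the inverse of \<open>inv h \<otimes> g\<close>, so left
      invariance in \<open>g\<close> removes \<open>h\<close>.\<close>
    have "(\<integral>\<^sup>+g. F (\<rho> (inv g) (\<rho> h x)) \<partial>Q) = (\<integral>\<^sup>+g. F (\<rho> (inv (inv h \<otimes> g)) x) \<partial>Q)"
      using h by (intro nn_integral_cong) (simp add: space_Q inv_mult_group composition_rule[OF x])
    also have "\<dots> = (\<integral>\<^sup>+g. F (\<rho> (inv g) x) \<partial>Q)"
      by (intro nn_integral_left_mult[OF h(2)]) measurable
    finally show "(\<integral>\<^sup>+g. F (\<rho> (inv g) (\<rho> h x)) \<partial>Q) = (\<integral>\<^sup>+g. F (\<rho> (inv g) x) \<partial>Q)" .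
  qed
  also have "\<dots> = (\<integral>\<^sup>+g. F (\<rho> (inv g) x) \<partial>Q)"
    by (simp add: Q.emeasure_space_1)
  finally show ?thesis ..
qed

text \<open>Inversion turns a right translation into a left one. Since inverting \<open>g\<close>
  does not change the law of an orbit map, left invariance of \<open>Q\<close> is enough.\<close>

lemma nn_integral_act_right:
  assumes x: "x \<in> V" and h: "h \<in> carrier G" and [measurable]: "F \<in> borel_measurable (borel_on V)"
  shows "(\<integral>\<^sup>+g. F (\<rho> g (\<rho> h x)) \<partial>Q) = (\<integral>\<^sup>+g. F (\<rho> g x) \<partial>Q)"
proof -
  note [measurable] = measurable_inv
  have [measurable]: "(\<lambda>_. x) \<in> N \<rightarrow>\<^sub>M borel_on V" for N :: "'c measure"
    using x by (intro measurable_const) (simp add: space_V)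
  have h': "inv h \<in> carrier G" using h by simp
  have "(\<integral>\<^sup>+g. F (\<rho> g (\<rho> h x)) \<partial>Q) = (\<integral>\<^sup>+g. F (\<rho> (inv g) (\<rho> h x)) \<partial>Q)"
    using nn_integral_act_inv[OF act_closed[OF h x]] by simp
  also have "\<dots> = (\<integral>\<^sup>+g. F (\<rho> (inv (inv h \<otimes> g)) x) \<partial>Q)"
    using h h' by (intro nn_integral_cong) (simp add: space_Q inv_mult_group composition_rule[OF x])
  also have "\<dots> = (\<integral>\<^sup>+g. F (\<rho> (inv g) x) \<partial>Q)"
    by (intro nn_integral_left_mult[OF h']) measurable
  also have "\<dots> = (\<integral>\<^sup>+g. F (\<rho> g x) \<partial>Q)"
    by (rule nn_integral_act_inv) (use x in measurable)
  finally show ?thesis .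
qed

lemma distr_act_right:
  assumes x: "x \<in> V" and h: "h \<in> carrier G"
    and [measurable]: "F \<in> borel_on V \<rightarrow>\<^sub>M S"
  shows "distr Q S (\<lambda>g. F (\<rho> g (\<rho> h x))) = distr Q S (\<lambda>g. F (\<rho> g x))"
proof (rule measure_eqI)
  have const: "(\<lambda>_. y) \<in> Q \<rightarrow>\<^sub>M borel_on V" if "y \<in> V" for y
    using that by (intro measurable_const) (simp add: space_V)
  have meas: "(\<lambda>g. F (\<rho> g y)) \<in> Q \<rightarrow>\<^sub>M S" if "y \<in> V" for y
    using const[OF that] by measurable
  fix A assume "A \<in> sets (distr Q S (\<lambda>g. F (\<rho> g (\<rho> h x))))"
  then have [measurable]: "A \<in> sets S" by simp
  have "emeasure (distr Q S (\<lambda>g. F (\<rho> g y))) A = (\<integral>\<^sup>+g. indicator A (F (\<rho> g y)) \<partial>Q)"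
    if "y \<in> V" for y
    using meas[OF that]
    by (subst nn_integral_indicator[symmetric], simp, subst nn_integral_distr) auto
  moreover have "(\<integral>\<^sup>+g. indicator A (F (\<rho> g (\<rho> h x))) \<partial>Q) = (\<integral>\<^sup>+g. indicator A (F (\<rho> g x)) \<partial>Q)"
    by (rule nn_integral_act_right[OF x h]) measurable
  ultimately show "emeasure (distr Q S (\<lambda>g. F (\<rho> g (\<rho> h x)))) A = emeasure (distr Q S (\<lambda>g. F (\<rho> g x))) A"
    using x act_closed[OF h x] by simp
qed simp

end

section \<open>The randomization test\<close>

text \<open>The same member of the sequence, now with its noise and random group elements. The
  signal is a parameter of the individual lemmas.\<close>

locale randomization_model = haar_representation G T V p \<rho> Q + prob_space M
  for G :: "('g, 'b) monoid_scheme" (structure) and T V p \<rho> Q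
    and M :: "'w measure" +
  fixes f :: "'v::real_inner \<Rightarrow> real" and N :: "'w \<Rightarrow> 'v" and \<Gamma> :: "nat \<Rightarrow> 'w \<Rightarrow> 'g" and K :: nat
  assumes f [measurable]: "f \<in> borel_measurable (borel_on V)"
    and N [measurable]: "N \<in> M \<rightarrow>\<^sub>M borel_on V"
    and K: "1 \<le> K"
    and \<Gamma>_indep: "indep_vars (\<lambda>_. Q) \<Gamma> {1..K}"
    and \<Gamma>_distr: "\<And>i. i \<in> {1..K} \<Longrightarrow> distr M Q (\<Gamma> i) = Q"
    and N_indep: "indep_rv M (borel_on V) N (\<Pi>\<^sub>M i\<in>{1..K}. Q) (\<lambda>\<omega>. \<lambda>i\<in>{1..K}. \<Gamma> i \<omega>)"
begin

abbreviation "L \<equiv> distr M (borel_on V) N"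
abbreviation "QK \<equiv> \<Pi>\<^sub>M i\<in>{1..K}. Q"

sublocale L: prob_space L
  by (rule prob_space_distr) measurable

sublocale QK: prob_space QK
  by (intro prob_space_PiM Q.prob_space_axioms)

lemma measurable_\<Gamma>: "i \<in> {1..K} \<Longrightarrow> \<Gamma> i \<in> M \<rightarrow>\<^sub>M Q"
  using \<Gamma>_indep by (simp add: indep_vars_def)

lemma measurable_\<Gamma>s [measurable]: "(\<lambda>\<omega>. \<lambda>i\<in>{1..K}. \<Gamma> i \<omega>) \<in> M \<rightarrow>\<^sub>M QK"
  by (intro measurable_restrict measurable_\<Gamma>)

text \<open>The group elements are iid, so their vector has law \<open>QK\<close>; its independence
  of the noise makes the joint law a product.\<close>

lemma distr_joint:
  "distr M (borel_on V \<Otimes>\<^sub>M QK) (\<lambda>\<omega>. (N \<omega>, \<lambda>i\<in>{1..K}. \<Gamma> i \<omega>)) = L \<Otimes>\<^sub>M QK"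
proof -
  have "distr M QK (\<lambda>\<omega>. \<lambda>i\<in>{1..K}. \<Gamma> i \<omega>) = (\<Pi>\<^sub>M i\<in>{1..K}. distr M Q (\<Gamma> i))"
    using K \<Gamma>_indep measurable_\<Gamma> by (subst indep_vars_iff_distr_eq_PiM'[symmetric]) auto
  also have "\<dots> = QK" by (intro PiM_cong) (simp_all add: \<Gamma>_distr)
  finally show ?thesis using indep_rv_distr[OF N_indep] by simp
qed

lemma nn_integral_joint:
  assumes [measurable]: "F \<in> borel_measurable (borel_on V \<Otimes>\<^sub>M QK)"
  shows "(\<integral>\<^sup>+\<omega>. F (N \<omega>, \<lambda>i\<in>{1..K}. \<Gamma> i \<omega>) \<partial>M) = (\<integral>\<^sup>+x. (\<integral>\<^sup>+g. F (x, g) \<partial>QK) \<partial>L)"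
proof -
  have "(\<integral>\<^sup>+\<omega>. F (N \<omega>, \<lambda>i\<in>{1..K}. \<Gamma> i \<omega>) \<partial>M) = (\<integral>\<^sup>+z. F z \<partial>(L \<Otimes>\<^sub>M QK))"
    unfolding distr_joint[symmetric] by (rule nn_integral_distr[symmetric]) measurable
  also have "\<dots> = (\<integral>\<^sup>+x. (\<integral>\<^sup>+g. F (x, g) \<partial>QK) \<partial>L)"
    by (intro QK.nn_integral_fst[symmetric]) measurable
  finally show ?thesis .
qed

lemma measurable_coordinate:
  assumes "F \<in> S \<rightarrow>\<^sub>M QK" "i \<in> {1..K}" shows "(\<lambda>z. F z i) \<in> S \<rightarrow>\<^sub>M Q"
  using measurable_compose[OF assms(1) measurable_component_singleton[OF assms(2)]] .

lemma measurable_const_V: "x \<in> V \<Longrightarrow> (\<lambda>_. x) \<in> S \<rightarrow>\<^sub>M borel_on V"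
  by (intro measurable_const) (simp add: space_V)

lemma measurable_statistic [measurable (raw)]:
  assumes "F \<in> S \<rightarrow>\<^sub>M Q" "Y \<in> S \<rightarrow>\<^sub>M borel_on V"
  shows "(\<lambda>z. f (\<rho> (F z) (Y z))) \<in> borel_measurable S"
  by (rule measurable_compose[OF measurable_act_compose[OF assms] f])

lemma pred_rank_statistic:
  assumes "Z \<in> borel_measurable S" "Y \<in> S \<rightarrow>\<^sub>M borel_on V" "\<And>i. i \<in> {1..K} \<Longrightarrow> F i \<in> S \<rightarrow>\<^sub>M Q"
  shows "Measurable.pred S (\<lambda>z. k \<le> card {i\<in>{1..K}. f (\<rho> (F i z) (Y z)) < Z z})"
  by (intro pred_rank measurable_statistic assms)

text \<open>The threshold \<open>y\<close> is an argument separate from the point \<open>x\<close>,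
  so that a group element can act on the observed statistic while the randomized ones stay on the
  orbit of \<open>x\<close>.\<close>

definition exceed :: "nat \<Rightarrow> real \<Rightarrow> 'v \<Rightarrow> (nat \<Rightarrow> 'g) \<Rightarrow> ennreal" where
  "exceed k y x g = (if k \<le> card {i\<in>{1..K}. f (\<rho> (g i) x) < y} then 1 else 0)"

lemma measurable_exceed [measurable (raw)]:
  assumes [measurable]: "Z \<in> borel_measurable S" "Y \<in> S \<rightarrow>\<^sub>M borel_on V" and F: "F \<in> S \<rightarrow>\<^sub>M QK"
  shows "(\<lambda>z. exceed k (Z z) (Y z) (F z)) \<in> borel_measurable S"
proof -
  have [measurable]: "Measurable.pred S (\<lambda>z. k \<le> card {i\<in>{1..K}. f (\<rho> (F z i) (Y z)) < Z z})"
    by (intro pred_rank_statistic measurable_coordinate assms)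
  show ?thesis unfolding exceed_def by measurable
qed

section \<open>Ranks along the orbit of one vector\<close>

context
  fixes x assumes x: "x \<in> V"
begin

abbreviation "D \<equiv> distr Q borel (\<lambda>g. f (\<rho> g x))"

lemma prob_space_D: "prob_space D"
  by (intro Q.prob_space_distr measurable_statistic measurable_const_V x) simp

text \<open>The right-hand side depends on \<open>x\<close> only through \<open>D\<close>, the law
  of the statistic along the orbit. Two points with the same such law therefore give the same
  integral.\<close>

lemma nn_integral_exceed:
  "(\<integral>\<^sup>+g. exceed k y x g \<partial>QK) =
   (\<integral>\<^sup>+z. (if k \<le> card {i\<in>{1..K}. z i < y} then 1 else 0) \<partial>(\<Pi>\<^sub>M i\<in>{1..K}. D))"
proof -
  interpret D: prob_space D by (rule prob_space_D)
  note [measurable] = measurable_const_V[OF x]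
  let ?F = "\<lambda>g. f (\<rho> g x)"
  let ?B = "\<Pi>\<^sub>M i\<in>{1..K}. (borel :: real measure)"
  have F: "?F \<in> borel_measurable Q" by measurable
  have "(\<Pi>\<^sub>M i\<in>{1..K}. D) = (\<Pi>\<^sub>M i\<in>{1..K}. distr Q D ?F)"
    by (intro PiM_cong distr_cong) auto
  also have "\<dots> = distr QK (\<Pi>\<^sub>M i\<in>{1..K}. D) (compose {1..K} ?F)"
    using F Q.prob_space_axioms D.prob_space_axioms
    by (intro distr_PiM_finite_prob_space'[symmetric]) auto
  also have "\<dots> = distr QK ?B (compose {1..K} ?F)"
    by (intro distr_cong refl sets_PiM_cong) auto
  finally have D: "(\<Pi>\<^sub>M i\<in>{1..K}. D) = distr QK ?B (compose {1..K} ?F)" .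
  have [measurable]: "Measurable.pred ?B (\<lambda>z. k \<le> card {i\<in>{1..K}. z i < y})"
    by (intro pred_rank) measurable
  have "(\<lambda>z. if k \<le> card {i\<in>{1..K}. z i < y} then 1 else 0 :: ennreal) \<in> borel_measurable ?B"
    by measurable
  moreover have "compose {1..K} ?F \<in> QK \<rightarrow>\<^sub>M ?B"
    unfolding compose_def by (intro measurable_restrict measurable_compose[OF _ F]) measurable
  ultimately have "(\<integral>\<^sup>+z. (if k \<le> card {i\<in>{1..K}. z i < y} then 1 else 0) \<partial>(\<Pi>\<^sub>M i\<in>{1..K}. D)) =
      (\<integral>\<^sup>+g. (if k \<le> card {i\<in>{1..K}. compose {1..K} ?F g i < y} then 1 else 0) \<partial>QK)"
    unfolding D by (intro nn_integral_distr) auto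
  also have "\<dots> = (\<integral>\<^sup>+g. exceed k y x g \<partial>QK)"
    by (simp add: exceed_def compose_def cong: conj_cong)
  finally show ?thesis ..
qed

text \<open>With \<open>h\<close> drawn from \<open>Q\<close>, the threshold has law
  \<open>D\<close> as well. Placed at index \<open>0\<close> it completes a vector of
  \<open>K + 1\<close> iid coordinates, to which \<open>prob_ranked_le\<close> applies.\<close>

lemma nn_integral_exceed_le:
  assumes k: "k \<le> Suc K"
  shows "(\<integral>\<^sup>+h. (\<integral>\<^sup>+g. exceed k (f (\<rho> h x)) x g \<partial>QK) \<partial>Q) \<le> ennreal (real (Suc K - k) / real (Suc K))"
proof -
  interpret D: prob_space D by (rule prob_space_D)
  interpret DD: product_sigma_finite "\<lambda>_. D" ..
  note [measurable] = measurable_const_V[OF x]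
  have ins: "insert 0 {1..K} = {0..K}" by auto
  let ?D = "\<Pi>\<^sub>M i\<in>{0..K}. D"
  interpret DK: prob_space ?D by (intro prob_space_PiM D.prob_space_axioms)
  have coord: "(\<lambda>z. z i) \<in> borel_measurable ?D" if "i \<in> {0..K}" for i
    using measurable_component_singleton[OF that, of "\<lambda>_. D"] by simp
  have pred: "Measurable.pred ?D (\<lambda>z. k \<le> card {i\<in>{0..K}. z i < z 0})"
    by (intro pred_rank coord) auto
  have "(\<integral>\<^sup>+h. (\<integral>\<^sup>+g. exceed k (f (\<rho> h x)) x g \<partial>QK) \<partial>Q) = (\<integral>\<^sup>+y. (\<integral>\<^sup>+g. exceed k y x g \<partial>QK) \<partial>D)"
    by (rule nn_integral_distr[symmetric]) measurable
  also have "\<dots> = (\<integral>\<^sup>+y. (\<integral>\<^sup>+z. (if k \<le> card {i\<in>{1..K}. z i < y} then 1 else 0) \<partial>(\<Pi>\<^sub>M i\<in>{1..K}. D)) \<partial>D)"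
    by (simp only: nn_integral_exceed)
  also have "\<dots> = (\<integral>\<^sup>+y. (\<integral>\<^sup>+z. (\<lambda>z. if k \<le> card {i\<in>{0..K}. z i < z 0} then 1 else 0) (z(0 := y))
      \<partial>(\<Pi>\<^sub>M i\<in>{1..K}. D)) \<partial>D)"
  proof -
    \<comment> \<open>Index \<open>0\<close> is not strictly below itself, so admitting it leaves
      the count unchanged.\<close>
    have "{i\<in>{0..K}. (z(0 := y)) i < (z(0 := y)) 0} = {i\<in>{1..K}. z i < y}" for z :: "nat \<Rightarrow> real" and y
      by (auto simp: Suc_le_eq)
    then show ?thesis by simp
  qed
  also have "\<dots> = (\<integral>\<^sup>+z. (if k \<le> card {i\<in>{0..K}. z i < z 0} then 1 else 0) \<partial>?D)"
    unfolding ins[symmetric]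
    by (rule DD.product_nn_integral_insert_rev[symmetric]) (use pred in \<open>simp_all add: ins\<close>)
  also have "\<dots> = (\<integral>\<^sup>+z. indicator {z\<in>space ?D. k \<le> card {i\<in>{0..K}. z i < z 0}} z \<partial>?D)"
    by (intro nn_integral_cong) (simp add: indicator_def)
  also have "\<dots> = emeasure ?D {z\<in>space ?D. k \<le> card {i\<in>{0..K}. z i < z 0}}"
    by (intro nn_integral_indicator predE pred)
  also have "\<dots> \<le> ennreal (real (Suc K - k) / real (Suc K))"
    unfolding DK.emeasure_eq_measure
    by (intro ennreal_leI prob_ranked_le D.prob_space_axioms k) simp
  finally show ?thesis .
qed

end

section \<open>Level and power under noise invariance\<close>

context
  assumes invariant: "\<And>g. g \<in> carrier G \<Longrightarrow> L = distr M (borel_on V) (\<lambda>\<omega>. \<rho> g (N \<omega>))"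
begin

lemma nn_integral_noise_act:
  assumes g: "g \<in> carrier G" and [measurable]: "F \<in> borel_measurable (borel_on V)"
  shows "(\<integral>\<^sup>+x. F (\<rho> g x) \<partial>L) = (\<integral>\<^sup>+x. F x \<partial>L)"
proof -
  have [measurable]: "(\<lambda>_. g) \<in> S \<rightarrow>\<^sub>M Q" for S :: "'c measure"
    using g by (intro measurable_const) (simp add: space_Q)
  have "(\<integral>\<^sup>+x. F x \<partial>L) = (\<integral>\<^sup>+\<omega>. F (\<rho> g (N \<omega>)) \<partial>M)"
    unfolding invariant[OF g] by (rule nn_integral_distr) measurable
  also have "\<dots> = (\<integral>\<^sup>+x. F (\<rho> g x) \<partial>L)"
    by (rule nn_integral_distr[symmetric]) measurable
  finally show ?thesis ..
qed

lemma prob_exceed_le: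
  assumes k: "k \<le> Suc K"
  shows "prob {\<omega>\<in>space M. k \<le> card {i\<in>{1..K}. f (\<rho> (\<Gamma> i \<omega>) (N \<omega>)) < f (N \<omega>)}}
    \<le> real (Suc K - k) / real (Suc K)" (is "prob ?E \<le> ?c")
proof -
  interpret QL: pair_sigma_finite Q L ..
  have E [measurable]: "?E \<in> events"
    by (intro predE pred_rank_statistic measurable_\<Gamma>) measurable
  have "emeasure M ?E = (\<integral>\<^sup>+\<omega>. indicator ?E \<omega> \<partial>M)"
    by (rule nn_integral_indicator[OF E, symmetric])
  also have "\<dots> = (\<integral>\<^sup>+\<omega>. exceed k (f (N \<omega>)) (N \<omega>) (\<lambda>i\<in>{1..K}. \<Gamma> i \<omega>) \<partial>M)"
    by (intro nn_integral_cong) (simp add: exceed_def indicator_def cong: conj_cong)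
  also have "\<dots> = (\<integral>\<^sup>+x. (\<integral>\<^sup>+g. exceed k (f x) x g \<partial>QK) \<partial>L)"
  proof -
    have "(\<lambda>(x, g). exceed k (f x) x g) \<in> borel_measurable (borel_on V \<Otimes>\<^sub>M QK)"
      by measurable
    from nn_integral_joint[OF this] show ?thesis by (simp only: prod.case)
  qed
  \<comment> \<open>A dummy average over \<open>h\<close>, possible because \<open>Q\<close> has
    total mass one.\<close>
  also have "\<dots> = (\<integral>\<^sup>+h. (\<integral>\<^sup>+x. (\<integral>\<^sup>+g. exceed k (f x) x g \<partial>QK) \<partial>L) \<partial>Q)"
    by (simp add: Q.emeasure_space_1)
  also have "\<dots> = (\<integral>\<^sup>+h. (\<integral>\<^sup>+x. (\<integral>\<^sup>+g. exceed k (f (\<rho> h x)) x g \<partial>QK) \<partial>L) \<partial>Q)"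
  proof (rule nn_integral_cong)
    fix h assume "h \<in> space Q"
    then have h: "h \<in> carrier G" by (simp add: space_Q)
    have "(\<integral>\<^sup>+x. (\<integral>\<^sup>+g. exceed k (f x) x g \<partial>QK) \<partial>L) =
        (\<integral>\<^sup>+x. (\<integral>\<^sup>+g. exceed k (f (\<rho> h x)) (\<rho> h x) g \<partial>QK) \<partial>L)"
      by (rule nn_integral_noise_act[OF h, symmetric]) measurable
    also have "\<dots> = (\<integral>\<^sup>+x. (\<integral>\<^sup>+g. exceed k (f (\<rho> h x)) x g \<partial>QK) \<partial>L)"
    proof (rule nn_integral_cong)
      fix x assume "x \<in> space L"
      then have x: "x \<in> V" by (simp add: space_V)
      show "(\<integral>\<^sup>+g. exceed k (f (\<rho> h x)) (\<rho> h x) g \<partial>QK) = (\<integral>\<^sup>+g. exceed k (f (\<rho> h x)) x g \<partial>QK)"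
        unfolding nn_integral_exceed[OF x] nn_integral_exceed[OF act_closed[OF h x]]
          distr_act_right[OF x h f] ..
    qed
    finally show "(\<integral>\<^sup>+x. (\<integral>\<^sup>+g. exceed k (f x) x g \<partial>QK) \<partial>L) =
        (\<integral>\<^sup>+x. (\<integral>\<^sup>+g. exceed k (f (\<rho> h x)) x g \<partial>QK) \<partial>L)" .
  qed
  \<comment> \<open>With the noise vector fixed on the outside, the inner double integral is the one
    bounded for a single orbit.\<close>
  also have "\<dots> = (\<integral>\<^sup>+x. (\<integral>\<^sup>+h. (\<integral>\<^sup>+g. exceed k (f (\<rho> h x)) x g \<partial>QK) \<partial>Q) \<partial>L)"
    by (rule QL.Fubini'[symmetric]) measurable
  also have "\<dots> \<le> (\<integral>\<^sup>+x. ennreal ?c \<partial>L)"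
    by (intro nn_integral_mono nn_integral_exceed_le k) (simp add: space_V)
  also have "\<dots> = ennreal ?c" by (simp only: nn_integral_const L.emeasure_space_1 mult_1_right)
  finally show ?thesis by (simp add: emeasure_eq_measure)
qed

text \<open>Given the value of the independent group element, the transformed noise has the law of
  \<open>N\<close> by invariance; Fubini averages over that value.\<close>

lemma prob_act_noise:
  assumes i: "i \<in> {1..K}" and [measurable]: "A \<in> sets (borel_on V)"
  shows "prob {\<omega>\<in>space M. \<rho> (\<Gamma> i \<omega>) (N \<omega>) \<in> A} = prob {\<omega>\<in>space M. N \<omega> \<in> A}"
proof -
  interpret LQ: pair_sigma_finite L QK ..
  note [measurable] = measurable_\<Gamma>[OF i] measurable_component_singleton[OF i, of "\<lambda>_. Q"]
  have "emeasure M {\<omega>\<in>space M. \<rho> (\<Gamma> i \<omega>) (N \<omega>) \<in> A} =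
      (\<integral>\<^sup>+\<omega>. indicator {\<omega>\<in>space M. \<rho> (\<Gamma> i \<omega>) (N \<omega>) \<in> A} \<omega> \<partial>M)" by simp
  also have "\<dots> = (\<integral>\<^sup>+\<omega>. indicator A (\<rho> ((\<lambda>i\<in>{1..K}. \<Gamma> i \<omega>) i) (N \<omega>)) \<partial>M)"
    using i by (intro nn_integral_cong) (simp add: indicator_def)
  also have "\<dots> = (\<integral>\<^sup>+x. (\<integral>\<^sup>+g. indicator A (\<rho> (g i) x) \<partial>QK) \<partial>L)"
  proof -
    have "(\<lambda>(x, g). indicator A (\<rho> (g i) x) :: ennreal) \<in> borel_measurable (borel_on V \<Otimes>\<^sub>M QK)"
      by measurable
    from nn_integral_joint[OF this] show ?thesis by (simp only: prod.case)
  qed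
  also have "\<dots> = (\<integral>\<^sup>+g. (\<integral>\<^sup>+x. indicator A (\<rho> (g i) x) \<partial>L) \<partial>QK)"
    by (rule LQ.Fubini'[symmetric]) measurable
  also have "\<dots> = (\<integral>\<^sup>+g. (\<integral>\<^sup>+x. indicator A x \<partial>L) \<partial>QK)"
  proof (rule nn_integral_cong)
    fix g assume "g \<in> space QK"
    then have "g i \<in> carrier G" using i by (auto simp: space_PiM space_Q)
    then show "(\<integral>\<^sup>+x. indicator A (\<rho> (g i) x) \<partial>L) = (\<integral>\<^sup>+x. indicator A x \<partial>L)"
      by (rule nn_integral_noise_act) measurable
  qed
  also have "\<dots> = (\<integral>\<^sup>+g. emeasure L A \<partial>QK)" by simp
  also have "\<dots> = emeasure L A" by (simp only: nn_integral_const QK.emeasure_space_1 mult_1_right)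
  also have "\<dots> = emeasure M {\<omega>\<in>space M. N \<omega> \<in> A}"
    by (subst emeasure_distr) (auto intro!: arg_cong[where f = "emeasure M"])
  finally show ?thesis by (simp add: emeasure_eq_measure)
qed

text \<open>Off the bad events the observed statistic exceeds all \<open>K\<close> randomized ones,
  which is enough because \<open>k \<le> K\<close>. The rest is a union bound.\<close>

lemma prob_exceed_ge:
  assumes \<psi>: "0 < \<psi>" and sub: "psi_subadditive \<psi> V f" and s: "s \<in> V" and k: "k \<le> K"
    and signal: "f s > t' / \<psi>\<^sup>2 + (1 / \<psi>) * (1 / \<psi> + 1) * t"
  shows "prob {\<omega>\<in>space M. k \<le> card {i\<in>{1..K}. f (\<rho> (\<Gamma> i \<omega>) (s + N \<omega>)) < f (s + N \<omega>)}}
    \<ge> 1 - (1 - prob {\<omega>\<in>space M. f (- N \<omega>) \<le> t})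
        - K * ((1 - prob {\<omega>\<in>space M. f (N \<omega>) \<le> t}) + (1 - measure Q {g\<in>space Q. f (\<rho> g s) \<le> t'}))"
    (is "prob ?E \<ge> _")
proof -
  have NV: "N \<omega> \<in> V" if "\<omega> \<in> space M" for \<omega>
    using measurable_space[OF N that] by (simp add: space_V)
  have shift: "(\<lambda>x. s + x) \<in> borel_on V \<rightarrow>\<^sub>M borel_on V"
    using s subspace_add[OF subspace_V]
    by (intro measurable_restrict_space3 borel_measurable_continuous_onI continuous_intros) auto
  have neg: "(\<lambda>x. - x) \<in> borel_on V \<rightarrow>\<^sub>M borel_on V"
    using subspace_neg[OF subspace_V]
    by (intro measurable_restrict_space3 borel_measurable_continuous_onI continuous_intros) auto
  note [measurable] = measurable_compose[OF N shift] measurable_compose[OF N neg] measurable_const_V[OF s]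
    measurable_\<Gamma>
  have E: "?E \<in> events"
    by (intro predE pred_rank_statistic measurable_\<Gamma>) measurable
  \<comment> \<open>The bad events: the negated noise is large, the transformed noise is large, the
    transformed signal is large.\<close>
  define B0 where "B0 = {\<omega>\<in>space M. \<not> f (- N \<omega>) \<le> t}"
  define B1 where "B1 i = {\<omega>\<in>space M. \<not> f (\<rho> (\<Gamma> i \<omega>) (N \<omega>)) \<le> t}" for i
  define B2 where "B2 i = {\<omega>\<in>space M. \<not> f (\<rho> (\<Gamma> i \<omega>) s) \<le> t'}" for i
  have meas: "B0 \<in> events" "\<And>i. i \<in> {1..K} \<Longrightarrow> B1 i \<in> events" "\<And>i. i \<in> {1..K} \<Longrightarrow> B2 i \<in> events"
    unfolding B0_def B1_def B2_def by measurable
  have p0: "prob B0 = 1 - prob {\<omega>\<in>space M. f (- N \<omega>) \<le> t}"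
    unfolding B0_def by (intro prob_neg) measurable
  have p1: "prob (B1 i) = 1 - prob {\<omega>\<in>space M. f (N \<omega>) \<le> t}" if i: "i \<in> {1..K}" for i
  proof -
    have "{x \<in> space (borel_on V). \<not> f x \<le> t} \<in> sets (borel_on V)" by measurable
    from prob_act_noise[OF i this] have "prob (B1 i) = prob {\<omega>\<in>space M. \<not> f (N \<omega>) \<le> t}"
      using i NV measurable_space[OF measurable_\<Gamma>]
      by (simp add: B1_def space_V space_Q act_closed cong: conj_cong)
    also have "\<dots> = 1 - prob {\<omega>\<in>space M. f (N \<omega>) \<le> t}" by (intro prob_neg) measurable
    finally show ?thesis .
  qed
  have p2: "prob (B2 i) = 1 - measure Q {g\<in>space Q. f (\<rho> g s) \<le> t'}" if i: "i \<in> {1..K}" for i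
  proof -
    note [measurable] = measurable_\<Gamma>[OF i]
    have "prob (B2 i) = measure (distr M Q (\<Gamma> i)) {g\<in>space Q. \<not> f (\<rho> g s) \<le> t'}"
      using measurable_space[OF measurable_\<Gamma>[OF i]]
      by (subst measure_distr) (auto simp: B2_def intro!: arg_cong[where f = prob])
    also have "\<dots> = 1 - measure Q {g\<in>space Q. f (\<rho> g s) \<le> t'}"
      unfolding \<Gamma>_distr[OF i] by (intro Q.prob_neg) measurable
    finally show ?thesis .
  qed
  have "space M - ?E \<subseteq> B0 \<union> (\<Union>i\<in>{1..K}. B1 i \<union> B2 i)"
  proof (rule ccontr)
    assume "\<not> space M - ?E \<subseteq> B0 \<union> (\<Union>i\<in>{1..K}. B1 i \<union> B2 i)"
    then obtain \<omega> where \<omega>: "\<omega> \<in> space M" "\<omega> \<notin> ?E" "f (- N \<omega>) \<le> t"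
      "\<And>i. i \<in> {1..K} \<Longrightarrow> f (\<rho> (\<Gamma> i \<omega>) (N \<omega>)) \<le> t" "\<And>i. i \<in> {1..K} \<Longrightarrow> f (\<rho> (\<Gamma> i \<omega>) s) \<le> t'"
      unfolding B0_def B1_def B2_def by blast
    have sN: "s + N \<omega> \<in> V" and mN: "- N \<omega> \<in> V"
      using NV[OF \<omega>(1)] s subspace_add[OF subspace_V] subspace_neg[OF subspace_V] by auto
    \<comment> \<open>Subadditivity for the decomposition of \<open>s\<close> into
      \<open>s + N \<omega>\<close> and \<open>- N \<omega>\<close>.\<close>
    have "\<psi> * f s \<le> f (s + N \<omega>) + f (- N \<omega>)"
      using sub sN mN unfolding psi_subadditive_def by (metis add_diff_cancel_right' diff_conv_add_uminus)
    \<comment> \<open>The constants in the signal condition are chosen for this: the final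
      \<open>t\<close> pays for the negated noise, and \<open>(t' + t) / \<psi>\<close> remains as
      the level separating observed from randomized statistics.\<close>
    moreover have "\<psi> * f s > (t' + t) / \<psi> + t"
    proof -
      have "(t' + t) / \<psi> + t = \<psi> * (t' / \<psi>\<^sup>2 + (1 / \<psi>) * (1 / \<psi> + 1) * t)"
        using \<psi> by (simp add: field_simps power2_eq_square)
      also have "\<dots> < \<psi> * f s" using signal \<psi> by simp
      finally show ?thesis .
    qed
    ultimately have large: "(t' + t) / \<psi> < f (s + N \<omega>)" using \<omega>(3) by linarith
    have small: "f (\<rho> (\<Gamma> i \<omega>) (s + N \<omega>)) \<le> (t' + t) / \<psi>" if i: "i \<in> {1..K}" for i
    proof -
      have g: "\<Gamma> i \<omega> \<in> carrier G" using measurable_space[OF measurable_\<Gamma>[OF i] \<omega>(1)] by (simp add: space_Q)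
      have "\<psi> * f (\<rho> (\<Gamma> i \<omega>) (s + N \<omega>)) \<le> f (\<rho> (\<Gamma> i \<omega>) s) + f (\<rho> (\<Gamma> i \<omega>) (N \<omega>))"
        using sub act_closed[OF g] s NV[OF \<omega>(1)]
        by (simp add: act_add[OF g] psi_subadditive_def)
      also have "\<dots> \<le> t' + t" using \<omega>(4,5)[OF i] by linarith
      finally show ?thesis using \<psi> by (simp add: field_simps)
    qed
    have "{i\<in>{1..K}. f (\<rho> (\<Gamma> i \<omega>) (s + N \<omega>)) < f (s + N \<omega>)} = {1..K}"
      using le_less_trans[OF small large] by auto
    then show False using \<omega>(1,2) k by simp
  qed
  then have "prob (space M - ?E) \<le> prob (B0 \<union> (\<Union>i\<in>{1..K}. B1 i \<union> B2 i))"
    using meas by (intro finite_measure_mono) auto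
  also have "\<dots> \<le> prob B0 + prob (\<Union>i\<in>{1..K}. B1 i \<union> B2 i)"
    using meas by (intro measure_Un_le) auto
  also have "prob (\<Union>i\<in>{1..K}. B1 i \<union> B2 i) \<le> (\<Sum>i\<in>{1..K}. prob (B1 i \<union> B2 i))"
    using meas by (intro finite_measure_subadditive_finite) auto
  also have "\<dots> \<le> (\<Sum>i\<in>{1..K}. prob (B1 i) + prob (B2 i))"
    using meas by (intro sum_mono measure_Un_le) auto
  also have "\<dots> = K * ((1 - prob {\<omega>\<in>space M. f (N \<omega>) \<le> t}) + (1 - measure Q {g\<in>space Q. f (\<rho> g s) \<le> t'}))"
    by (simp add: p1 p2)
  finally show ?thesis using p0 prob_compl[OF E] by simp
qed

end

end

section \<open>Level and consistency of the sequence of tests\<close>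

theorem theorem2p1:
  fixes \<alpha> \<psi> :: real
    and K :: nat
    and p :: "nat \<Rightarrow> nat"
    and V :: "nat \<Rightarrow> 'v::real_inner set"
    and \<Theta> \<Theta>1 :: "nat \<Rightarrow> 'v set"
    and G :: "nat \<Rightarrow> ('g, 'b) monoid_scheme"
    and T :: "nat \<Rightarrow> 'g topology"
    and Q :: "nat \<Rightarrow> 'g measure"
    and \<rho> :: "nat \<Rightarrow> 'g \<Rightarrow> 'v \<Rightarrow> 'v"
    and f :: "nat \<Rightarrow> 'v \<Rightarrow> real"
    and M :: "nat \<Rightarrow> 'w measure"
    and N :: "nat \<Rightarrow> 'w \<Rightarrow> 'v"
    and \<Gamma> :: "nat \<Rightarrow> nat \<Rightarrow> 'w \<Rightarrow> 'g"
    and X :: "nat \<Rightarrow> 'v \<Rightarrow> 'w \<Rightarrow> 'v"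
  assumes "0 < \<alpha>" and "\<alpha> \<le> 1" and "1 \<le> K" and "0 < \<psi>"
    and "\<And>m. m \<ge> 1 \<Longrightarrow> fin_dim_space (V m) (p m)"
    and "\<And>m. m \<ge> 1 \<Longrightarrow> \<Theta>1 m \<subseteq> V m"
    and "\<And>m. m \<ge> 1 \<Longrightarrow> \<Theta> m = {0} \<union> \<Theta>1 m"
    and "\<And>m. m \<ge> 1 \<Longrightarrow> compact_group (G m) (T m)"
    and "\<And>m. m \<ge> 1 \<Longrightarrow> haar_prob (G m) (T m) (Q m)"
    and "\<And>m. m \<ge> 1 \<Longrightarrow> linear_representation (G m) (T m) (V m) (\<rho> m)"
    and "\<And>m. m \<ge> 1 \<Longrightarrow> f m \<in> borel_measurable (borel_on (V m))"
    and "\<And>m. m \<ge> 1 \<Longrightarrow> psi_subadditive \<psi> (V m) (f m)"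
    and "\<And>m. m \<ge> 1 \<Longrightarrow> prob_space (M m)"
    and "\<And>m. m \<ge> 1 \<Longrightarrow> N m \<in> M m \<rightarrow>\<^sub>M borel_on (V m)"
    and "\<And>m. m \<ge> 1 \<Longrightarrow> prob_space.indep_vars (M m) (\<lambda>_. Q m) (\<Gamma> m) {1..K}"
    and "\<And>m i. m \<ge> 1 \<Longrightarrow> i \<in> {1..K} \<Longrightarrow> distr (M m) (Q m) (\<Gamma> m i) = Q m"
    and "\<And>m. m \<ge> 1 \<Longrightarrow>
           indep_rv (M m) (borel_on (V m)) (N m)
             (\<Pi>\<^sub>M i\<in>{1..K}. Q m) (\<lambda>\<omega>. \<lambda>i\<in>{1..K}. \<Gamma> m i \<omega>)"
    and "\<And>m s \<omega>. m \<ge> 1 \<Longrightarrow> s \<in> \<Theta> m \<Longrightarrow> \<omega> \<in> space (M m) \<Longrightarrow> X m s \<omega> = s + N m \<omega>"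
  shows "(noise_invariance G V \<rho> M N \<longrightarrow>
            (\<forall>m\<ge>1. \<P>(\<omega> in M m. rejects \<alpha> K (f m) (\<rho> m) (\<lambda>i. \<Gamma> m i \<omega>) (X m 0 \<omega>)) \<le> \<alpha>)) \<and>
         (noise_invariance G V \<rho> M N \<and> signal_strength \<psi> Q \<rho> f \<Theta>1 M N \<and>
          1 \<le> \<alpha> * real (K + 1) \<longrightarrow>
            (\<forall>s. (\<forall>m\<ge>1. s m \<in> \<Theta>1 m) \<longrightarrow>
              (\<lambda>m. \<P>(\<omega> in M m. rejects \<alpha> K (f m) (\<rho> m) (\<lambda>i. \<Gamma> m i \<omega>) (X m (s m) \<omega>))) \<longlonglongrightarrow> 1))"
proof -
  define k where "k = nat \<lceil>(1 - \<alpha>) * real (K + 1)\<rceil>"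
  have k_ge: "(1 - \<alpha>) * real (K + 1) \<le> real k"
    unfolding k_def by (rule real_nat_ceiling_ge)
  have "(1 - \<alpha>) * real (K + 1) \<le> 1 * real (K + 1)"
    using assms(1) by (intro mult_right_mono) auto
  then have k_le: "k \<le> Suc K"
    unfolding k_def by (simp add: ceiling_le_iff nat_le_iff)
  \<comment> \<open>Rounding up in \<open>k\<close> gives
    \<open>K + 1 - k \<le> \<alpha> * (K + 1)\<close>.\<close>
  have level: "real (Suc K - k) / real (Suc K) \<le> \<alpha>"
    using k_ge k_le by (simp add: of_nat_diff field_simps)
  have model: "randomization_model (G m) (T m) (V m) (p m) (\<rho> m) (Q m) (M m) (f m) (N m) (\<Gamma> m) K"
    if "m \<ge> 1" for m
    using that assms
    by (intro randomization_model.intro haar_representation.intro randomization_model_axioms.intro) auto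
  have reject_set: "{\<omega>\<in>space (M m). rejects \<alpha> K (f m) (\<rho> m) (\<lambda>i. \<Gamma> m i \<omega>) (X m s \<omega>)} =
      {\<omega>\<in>space (M m). k \<le> card {i\<in>{1..K}. f m (\<rho> m (\<Gamma> m i \<omega>) (s + N m \<omega>)) < f m (s + N m \<omega>)}}"
    if "m \<ge> 1" "s \<in> \<Theta> m" for m s
    using assms(1,2) that by (intro Collect_cong conj_cong refl) (simp add: rejects_iff k_def assms(18))
  show ?thesis
  proof (intro conjI impI allI)
    fix m :: nat assume inv: "noise_invariance G V \<rho> M N" and m: "1 \<le> m"
    interpret randomization_model "G m" "T m" "V m" "p m" "\<rho> m" "Q m" "M m" "f m" "N m" "\<Gamma> m" K
      by (rule model[OF m])
    have "0 \<in> \<Theta> m" using assms(7)[OF m] by simp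
    note reject_set[OF m this]
    also have "prob {\<omega>\<in>space (M m). k \<le> card {i\<in>{1..K}. f m (\<rho> m (\<Gamma> m i \<omega>) (0 + N m \<omega>)) < f m (0 + N m \<omega>)}} \<le> \<alpha>"
      using prob_exceed_le[OF _ k_le] inv m level by (simp add: noise_invariance_def)
    finally show "\<P>(\<omega> in M m. rejects \<alpha> K (f m) (\<rho> m) (\<lambda>i. \<Gamma> m i \<omega>) (X m 0 \<omega>)) \<le> \<alpha>" .
  next
    fix s
    assume A: "noise_invariance G V \<rho> M N \<and> signal_strength \<psi> Q \<rho> f \<Theta>1 M N \<and> 1 \<le> \<alpha> * real (K + 1)"
      and s: "\<forall>m\<ge>1. s m \<in> \<Theta>1 m"
    \<comment> \<open>The condition on \<open>\<alpha>\<close> enters here: the rank needed for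
      rejection can be reached with \<open>K\<close> randomized statistics.\<close>
    have "(1 - \<alpha>) * real (K + 1) \<le> real K" using A by (simp add: algebra_simps)
    then have k: "k \<le> K" unfolding k_def by (simp add: ceiling_le_iff nat_le_iff)
    obtain t t' :: "nat \<Rightarrow> real" where
      noise: "(\<lambda>m. \<P>(\<omega> in M m. f m (N m \<omega>) \<le> t m)) \<longlonglongrightarrow> 1"
        "(\<lambda>m. \<P>(\<omega> in M m. f m (- N m \<omega>) \<le> t m)) \<longlonglongrightarrow> 1"
      and signal: "\<forall>\<^sub>F m in sequentially. f m (s m) > t' m / \<psi>\<^sup>2 + (1 / \<psi>) * (1 / \<psi> + 1) * t m"
      and orbit: "(\<lambda>m. \<P>(g in Q m. f m (\<rho> m g (s m)) \<le> t' m)) \<longlonglongrightarrow> 1"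
      using A s unfolding signal_strength_def by blast
    \<comment> \<open>The bound of \<open>prob_exceed_ge\<close>; as \<open>K\<close> is fixed, its
      finitely many error terms vanish together.\<close>
    define lower where "lower m = 1 - (1 - \<P>(\<omega> in M m. f m (- N m \<omega>) \<le> t m))
        - K * ((1 - \<P>(\<omega> in M m. f m (N m \<omega>) \<le> t m)) + (1 - \<P>(g in Q m. f m (\<rho> m g (s m)) \<le> t' m)))" for m
    let ?power = "\<lambda>m. \<P>(\<omega> in M m. rejects \<alpha> K (f m) (\<rho> m) (\<lambda>i. \<Gamma> m i \<omega>) (X m (s m) \<omega>))"
    show "?power \<longlonglongrightarrow> 1"
    proof (rule tendsto_sandwich)
      have "lower \<longlonglongrightarrow> 1 - (1 - 1) - real K * ((1 - 1) + (1 - 1))"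
        unfolding lower_def by (intro tendsto_intros noise orbit)
      then show "lower \<longlonglongrightarrow> 1" by simp
      show "\<forall>\<^sub>F m in sequentially. lower m \<le> ?power m"
        using signal eventually_ge_at_top[of 1]
      proof eventually_elim
        case (elim m)
        interpret randomization_model "G m" "T m" "V m" "p m" "\<rho> m" "Q m" "M m" "f m" "N m" "\<Gamma> m" K
          by (rule model[OF elim(2)])
        have sm: "s m \<in> V m" "s m \<in> \<Theta> m" using s assms(6,7)[OF elim(2)] elim(2) by auto
        have inv: "L = distr (M m) (borel_on (V m)) (\<lambda>\<omega>. \<rho> m g (N m \<omega>))" if "g \<in> carrier (G m)" for g
          using A elim(2) that by (simp add: noise_invariance_def)
        show ?case
          unfolding reject_set[OF elim(2) sm(2)] lower_def
          by (rule prob_exceed_ge[OF inv assms(4) assms(12)[OF elim(2)] sm(1) k elim(1)])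
      qed
      show "\<forall>\<^sub>F m in sequentially. ?power m \<le> 1"
        using eventually_ge_at_top[of 1]
        by eventually_elim (rule prob_space.prob_le_1[OF assms(13)])
    qed simp
  qed
qed

end
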